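(* The four operads $(\mathsf{scpx},\{\circ_i\})$, $(\mathsf{scpx}_{\neq\emptyset},\{\circ_i\})$, $(\mathsf{scpx},\{\circ_i^c\})$ and $(\mathsf{scpx}_{\neq\emptyset},\{\circ_i^c\})$ have infinitely many generators, i.e. none of them is finitely generated as an operad.
   Context: For $n\ge1$ let $[n]=\{1,\dots,n\}$. A simplicial complex on $[n]$ is a family $K$ of subsets of $[n]$ closed under taking subsets; the empty family $\emptyset$ is allowed (empty simplicial complex), and ghost vertices (elements $i\in[n]$ with $\{i\}\notin K$) are allowed. $\mathsf{scpx}(n)$ is the set of simplicial complexes on $[n]$, $n\ge1$, and $\mathsf{scpx}_{\neq\emptyset}(n)$ the set of those different from the empty family (the complex $\{\emptyset\}$ is allowed); there are no operations of arity $0$. The group $\mathbb{S}_n$ acts by relabelling vertices. For $I\subseteq[n]$, $k\in[n]$, put $I^{<k}=\{i\in I\mid i<k\}$, $I^{>k}=\{i\in I\mid i>k\}$ and $I+\ell=\{i+\ell\mid i\in I\}$. For $I\subseteq[n]$, $J\subseteq[m]$, $k\in[n]$ define $I\circ_kJ=I^{<k}\sqcup(J+k-1)\sqcup(I^{>k}+m-1)$ if $k\in I$ and $I\circ_kJ=I^{<k}\sqcup(I^{>k}+m-1)$ if $k\notin I$; $I\circ_k^cJ=I^{<k}\sqcup([m]+k-1)\sqcup(I^{>k}+m-1)$ if $k\in I$ and $I\circ_k^cJ=I^{<k}\sqcup(J+k-1)\sqcup(I^{>k}+m-1)$ if $k\notin I$. Substitution operad: $K\circ_kL=\{I\circ_kJ\mid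 I\in K,J\in L\}$, with unit $\{\emptyset,\{1\}\}$ on $[1]$. Composition operad: $K\circ_k^cL$ is the set of all subsets of the sets $I\circ_k^cJ$ with $I\in K$, $J\in L$, with unit $\{\emptyset\}$ on $[1]$. *)

theory Defs
  imports Main "HOL-Combinatorics.Permutations"
begin

section \<open>Symmetric operads in sets, by partial compositions\<close>

text \<open>
  The field \<open>pcomp\<close> takes the arities explicitly: \<open>pcomp P n m k x y\<close> is
  $x \circ_k y$ for $x \in P(n)$, $y \in P(m)$ and $k \in [n]$. The symmetric groups act
  from the left. The permutations of $[n]$ are the functions \<open>\<sigma>\<close> with
  \<open>\<sigma> permutes {1..n}\<close>.
\<close>

record 'a operad =
  ops :: "nat \<Rightarrow> 'a set"
  act :: "nat \<Rightarrow> (nat \<Rightarrow> nat) \<Rightarrow> 'a \<Rightarrow> 'a"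
  pcomp :: "nat \<Rightarrow> nat \<Rightarrow> nat \<Rightarrow> 'a \<Rightarrow> 'a \<Rightarrow> 'a"
  opunit :: 'a

text \<open>
  Inserting \<open>m\<close> inputs at position \<open>k\<close> moves the input $a \neq k$ to \<open>shift m k a\<close>.
  For permutations \<open>\<sigma>\<close> of $[n]$ and \<open>\<tau>\<close> of $[m]$, \<open>block_perm m k \<sigma> \<tau>\<close> is the permutation
  $\sigma \circ_k \tau$ of $[n+m-1]$, which moves the block $\{k,\dots,k+m-1\}$ to the block
  starting at $\sigma(k)$, permuting it by \<open>\<tau>\<close>, and the other inputs according to \<open>\<sigma>\<close>.
\<close>

definition shift :: "nat \<Rightarrow> nat \<Rightarrow> nat \<Rightarrow> nat" where
  "shift m k a = (if a < k then a else a + m - 1)"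

definition block_perm :: "nat \<Rightarrow> nat \<Rightarrow> (nat \<Rightarrow> nat) \<Rightarrow> (nat \<Rightarrow> nat) \<Rightarrow> nat \<Rightarrow> nat" where
  "block_perm m k \<sigma> \<tau> i =
     (if i < k then shift m (\<sigma> k) (\<sigma> i)
      else if i < k + m then \<sigma> k - 1 + \<tau> (i - k + 1)
      else shift m (\<sigma> k) (\<sigma> (i - m + 1)))"

locale symmetric_operad =
  fixes P :: "'a operad"
  assumes no_nullary: "ops P 0 = {}"
    and unit_closed: "opunit P \<in> ops P 1"
    and act_closed: "\<lbrakk>\<sigma> permutes {1..n}; x \<in> ops P n\<rbrakk> \<Longrightarrow> act P n \<sigma> x \<in> ops P n"
    and comp_closed: "\<lbrakk>x \<in> ops P n; y \<in> ops P m; k \<in> {1..n}\<rbrakk>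
          \<Longrightarrow> pcomp P n m k x y \<in> ops P (n + m - 1)"
    and act_id: "x \<in> ops P n \<Longrightarrow> act P n id x = x"
    and act_comp: "\<lbrakk>\<sigma> permutes {1..n}; \<tau> permutes {1..n}; x \<in> ops P n\<rbrakk>
          \<Longrightarrow> act P n (\<sigma> \<circ> \<tau>) x = act P n \<sigma> (act P n \<tau> x)"
    and unit_left: "x \<in> ops P n \<Longrightarrow> pcomp P 1 n 1 (opunit P) x = x"
    and unit_right: "\<lbrakk>x \<in> ops P n; k \<in> {1..n}\<rbrakk> \<Longrightarrow> pcomp P n 1 k x (opunit P) = x"
    and sequential: "\<lbrakk>x \<in> ops P l; y \<in> ops P m; z \<in> ops P n; i \<in> {1..l}; j \<in> {1..m}\<rbrakk>
          \<Longrightarrow> pcomp P (l + m - 1) n (i - 1 + j) (pcomp P l m i x y) z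
             = pcomp P l (m + n - 1) i x (pcomp P m n j y z)"
    and parallel: "\<lbrakk>x \<in> ops P l; y \<in> ops P m; z \<in> ops P n; i \<in> {1..l}; k \<in> {1..l}; i < k\<rbrakk>
          \<Longrightarrow> pcomp P (l + m - 1) n (k - 1 + m) (pcomp P l m i x y) z
             = pcomp P (l + n - 1) m i (pcomp P l n k x z) y"
    and equivariant: "\<lbrakk>x \<in> ops P n; y \<in> ops P m; k \<in> {1..n};
             \<sigma> permutes {1..n}; \<tau> permutes {1..m}\<rbrakk>
          \<Longrightarrow> pcomp P n m (\<sigma> k) (act P n \<sigma> x) (act P m \<tau> y)
             = act P (n + m - 1) (block_perm m k \<sigma> \<tau>) (pcomp P n m k x y)"

text \<open>
  Since an element may belong to several arities (a simplicial complex does not determine its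
  set of vertices, because of ghost vertices), operations are paired with their arity.
\<close>

definition operations :: "'a operad \<Rightarrow> (nat \<times> 'a) set" where
  "operations P = {(n, x). x \<in> ops P n}"

inductive_set generated :: "'a operad \<Rightarrow> (nat \<times> 'a) set \<Rightarrow> (nat \<times> 'a) set"
  for P :: "'a operad" and X :: "(nat \<times> 'a) set" where
    gen: "(n, x) \<in> X \<Longrightarrow> (n, x) \<in> generated P X"
  | unit: "(1, opunit P) \<in> generated P X"
  | act: "\<lbrakk>(n, x) \<in> generated P X; \<sigma> permutes {1..n}\<rbrakk> \<Longrightarrow> (n, act P n \<sigma> x) \<in> generated P X"
  | comp: "\<lbrakk>(n, x) \<in> generated P X; (m, y) \<in> generated P X; k \<in> {1..n}\<rbrakk>
      \<Longrightarrow> (n + m - 1, pcomp P n m k x y) \<in> generated P X"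

definition finitely_generated :: "'a operad \<Rightarrow> bool" where
  "finitely_generated P \<longleftrightarrow>
     (\<exists>X. finite X \<and> X \<subseteq> operations P \<and> generated P X = operations P)"


section \<open>Simplicial complexes\<close>

definition scpx :: "nat \<Rightarrow> nat set set set" where
  "scpx n = {K. 1 \<le> n \<and> K \<subseteq> Pow {1..n} \<and> (\<forall>I\<in>K. \<forall>J. J \<subseteq> I \<longrightarrow> J \<in> K)}"

definition scpx_nonempty :: "nat \<Rightarrow> nat set set set" where
  "scpx_nonempty n = {K \<in> scpx n. K \<noteq> {}}"

definition relabel :: "(nat \<Rightarrow> nat) \<Rightarrow> nat set set \<Rightarrow> nat set set" where
  "relabel \<sigma> K = {\<sigma> ` I | I. I \<in> K}"

text \<open>
  \<open>sub_set m k I J\<close> and \<open>com_set m k I J\<close> are $I \circ_k J$ and $I \circ^c_k J$ for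
  $I \subseteq [n]$, $J \subseteq [m]$ and $k \in [n]$; they do not depend on \<open>n\<close>.
  The truncated subtractions are harmless, as all elements of $I$ and $J$ are positive.
\<close>

definition sub_set :: "nat \<Rightarrow> nat \<Rightarrow> nat set \<Rightarrow> nat set \<Rightarrow> nat set" where
  "sub_set m k I J =
     (if k \<in> I
      then {i \<in> I. i < k} \<union> (\<lambda>j. j + k - 1) ` J \<union> (\<lambda>i. i + m - 1) ` {i \<in> I. i > k}
      else {i \<in> I. i < k} \<union> (\<lambda>i. i + m - 1) ` {i \<in> I. i > k})"

definition com_set :: "nat \<Rightarrow> nat \<Rightarrow> nat set \<Rightarrow> nat set \<Rightarrow> nat set" where
  "com_set m k I J =
     (if k \<in> I
      then {i \<in> I. i < k} \<union> (\<lambda>j. j + k - 1) ` {1..m} \<union> (\<lambda>i. i + m - 1) ` {i \<in> I. i > k}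
      else {i \<in> I. i < k} \<union> (\<lambda>j. j + k - 1) ` J \<union> (\<lambda>i. i + m - 1) ` {i \<in> I. i > k})"

definition sub_comp :: "nat \<Rightarrow> nat \<Rightarrow> nat set set \<Rightarrow> nat set set \<Rightarrow> nat set set" where
  "sub_comp m k K L = {sub_set m k I J | I J. I \<in> K \<and> J \<in> L}"

definition com_comp :: "nat \<Rightarrow> nat \<Rightarrow> nat set set \<Rightarrow> nat set set \<Rightarrow> nat set set" where
  "com_comp m k K L = {S. \<exists>I\<in>K. \<exists>J\<in>L. S \<subseteq> com_set m k I J}"

definition substitution_operad :: "nat set set operad" where
  "substitution_operad =
     \<lparr>ops = scpx, act = (\<lambda>n. relabel), pcomp = (\<lambda>n. sub_comp), opunit = {{}, {1}}\<rparr>"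

definition substitution_operad_nonempty :: "nat set set operad" where
  "substitution_operad_nonempty = substitution_operad\<lparr>ops := scpx_nonempty\<rparr>"

definition composition_operad :: "nat set set operad" where
  "composition_operad =
     \<lparr>ops = scpx, act = (\<lambda>n. relabel), pcomp = (\<lambda>n. com_comp), opunit = {{}}\<rparr>"

definition composition_operad_nonempty :: "nat set set operad" where
  "composition_operad_nonempty = composition_operad\<lparr>ops := scpx_nonempty\<rparr>"


section \<open>The operad axioms\<close>

lemma mem_sub_set:
  assumes "1 \<le> k" "1 \<le> m" "J \<subseteq> {1..m}"
  shows "a \<in> sub_set m k I J \<longleftrightarrow>
    (if a < k then a \<in> I else if a < k + m then k \<in> I \<and> a + 1 - k \<in> J else a + 1 - m \<in> I)"
proof -
  have A: "a \<in> (\<lambda>j. j + k - 1) ` J \<longleftrightarrow> k \<le> a \<and> a < k + m \<and> a + 1 - k \<in> J"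
  proof
    assume "k \<le> a \<and> a < k + m \<and> a + 1 - k \<in> J"
    then show "a \<in> (\<lambda>j. j + k - 1) ` J"
      by (intro image_eqI[of _ _ "a + 1 - k"]) auto
  next
    assume "a \<in> (\<lambda>j. j + k - 1) ` J"
    then obtain j where "j \<in> J" "a = j + k - 1" by blast
    moreover have "j \<in> {1..m}" using \<open>j \<in> J\<close> assms by blast
    ultimately show "k \<le> a \<and> a < k + m \<and> a + 1 - k \<in> J" using assms by auto
  qed
  have B: "a \<in> (\<lambda>i. i + m - 1) ` {i \<in> I. i > k} \<longleftrightarrow> k + m \<le> a \<and> a + 1 - m \<in> I"
  proof
    assume "k + m \<le> a \<and> a + 1 - m \<in> I"
    then show "a \<in> (\<lambda>i. i + m - 1) ` {i \<in> I. i > k}"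
      by (intro image_eqI[of _ _ "a + 1 - m"]) auto
  next
    assume "a \<in> (\<lambda>i. i + m - 1) ` {i \<in> I. i > k}"
    then obtain i where "i \<in> I" "i > k" "a = i + m - 1" by auto
    then show "k + m \<le> a \<and> a + 1 - m \<in> I" using assms by auto
  qed
  have "a \<in> sub_set m k I J \<longleftrightarrow> a \<in> I \<and> a < k \<or>
      k \<in> I \<and> a \<in> (\<lambda>j. j + k - 1) ` J \<or> a \<in> (\<lambda>i. i + m - 1) ` {i \<in> I. i > k}"
    unfolding sub_set_def by auto
  then show ?thesis
    unfolding A B by auto
qed

lemma mem_com_set:
  assumes "1 \<le> k" "1 \<le> m" "J \<subseteq> {1..m}"
  shows "a \<in> com_set m k I J \<longleftrightarrow>
    (if a < k then a \<in> I else if a < k + m then k \<in> I \<or> a + 1 - k \<in> J else a + 1 - m \<in> I)"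
proof -
  define J' where "J' = (if k \<in> I then {1..m} else J)"
  have J': "J' \<subseteq> {1..m}" using assms by (auto simp: J'_def)
  have "com_set m k I J = sub_set m k (insert k I) J'"
    unfolding com_set_def sub_set_def J'_def by (simp; blast)
  then show ?thesis
    using mem_sub_set[OF assms(1,2) J', of a "insert k I"] assms
    by (auto simp: J'_def less_diff_conv)
qed

lemma sub_set_subset:
  assumes "k \<in> {1..n}" "1 \<le> m" "I \<subseteq> {1..n}" "J \<subseteq> {1..m}"
  shows "sub_set m k I J \<subseteq> {1..n + m - 1}"
proof
  have km: "1 \<le> k" using assms by simp
  fix a assume "a \<in> sub_set m k I J"
  then consider "a \<in> {1..n}" "a < k" | "a + 1 - k \<in> {1..m}" "\<not> a < k" | "a + 1 - m \<in> {1..n}"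
    using assms(3,4) mem_sub_set[OF km assms(2,4), of a I] by (metis subsetD)
  then show "a \<in> {1..n + m - 1}" using assms(1,2) by cases auto
qed

lemma com_set_subset:
  assumes "k \<in> {1..n}" "1 \<le> m" "I \<subseteq> {1..n}" "J \<subseteq> {1..m}"
  shows "com_set m k I J \<subseteq> {1..n + m - 1}"
proof
  have km: "1 \<le> k" using assms by simp
  fix a assume "a \<in> com_set m k I J"
  then consider "a \<in> {1..n}" "a < k" | "a < k + m" "\<not> a < k" | "a + 1 - m \<in> {1..n}"
    using assms(3,4) mem_com_set[OF km assms(2,4), of a I] by (metis subsetD)
  then show "a \<in> {1..n + m - 1}" using assms(1,2) by cases auto
qed

lemma com_set_mono:
  assumes "1 \<le> k" "1 \<le> m" "I \<subseteq> I'" "J \<subseteq> J'" "J' \<subseteq> {1..m}"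
  shows "com_set m k I J \<subseteq> com_set m k I' J'"
proof
  fix a assume "a \<in> com_set m k I J"
  moreover have "J \<subseteq> {1..m}" using assms by blast
  ultimately show "a \<in> com_set m k I' J'"
    using mem_com_set[OF assms(1,2), of J a I] mem_com_set[OF assms(1,2,5), of a I'] assms(3,4)
    by (auto split: if_splits)
qed

lemma sub_set_seq:
  assumes "J \<subseteq> {1..m}" "N \<subseteq> {1..n}" "1 \<le> i" "j \<in> {1..m}" "1 \<le> n"
  shows "sub_set n (i - 1 + j) (sub_set m i I J) N = sub_set (m + n - 1) i I (sub_set n j J N)"
proof (rule set_eqI)
  fix a
  have JN: "sub_set n j J N \<subseteq> {1..m + n - 1}" by (rule sub_set_subset) (use assms in auto)
  have eqs: "1 \<le> m" "1 \<le> i - 1 + j" "1 \<le> j" "1 \<le> m + n - 1" "j \<le> m" using assms by auto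
  note mem = mem_sub_set[OF eqs(2) assms(5,2)] mem_sub_set[OF assms(3) eqs(1) assms(1)]
    mem_sub_set[OF assms(3) eqs(4) JN] mem_sub_set[OF eqs(3) assms(5,2)]
  have arith: "i - 1 + j + 1 - i = j" "i - 1 + j < i + m" "\<not> i - 1 + j < i" using assms by auto
  consider "a < i" | "i \<le> a" "a < i - 1 + j" | "i - 1 + j \<le> a" "a < i - 1 + j + n"
    | "i - 1 + j + n \<le> a" "a + 1 < i + m + n" | "i + m + n \<le> a + 1" by linarith
  then show "a \<in> sub_set n (i - 1 + j) (sub_set m i I J) N \<longleftrightarrow>
        a \<in> sub_set (m + n - 1) i I (sub_set n j J N)"
  proof cases
    case 1
    then have "a < i - 1 + j" using assms by auto
    with 1 show ?thesis unfolding mem by simp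
  next
    case 2
    then have "a < i + m" "a < i + (m + n - 1)" "a + 1 - i < j" "\<not> a < i"
      using assms eqs by auto
    with 2 show ?thesis unfolding mem by simp
  next
    case 3
    then have "\<not> a < i" "a < i + (m + n - 1)" "\<not> a + 1 - i < j" "a + 1 - i < j + n"
      "\<not> a < i - 1 + j" "a + 1 - (i - 1 + j) = a + 1 - i + 1 - j"
      using assms eqs by auto
    with 3 show ?thesis unfolding mem arith by (simp only: if_True if_False arith) blast
  next
    case 4
    then have "\<not> a < i" "a < i + (m + n - 1)" "\<not> a + 1 - i < j" "\<not> a + 1 - i < j + n"
      "\<not> a < i - 1 + j" "\<not> a < i - 1 + j + n" "\<not> a + 1 - n < i" "a + 1 - n < i + m"
      "a + 1 - n + 1 - i = a + 1 - i + 1 - n"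
      using assms eqs by auto
    then show ?thesis unfolding mem by (simp only: if_True if_False)
  next
    case 5
    then have "\<not> a < i" "\<not> a < i + (m + n - 1)"
      "\<not> a < i - 1 + j" "\<not> a < i - 1 + j + n" "\<not> a + 1 - n < i" "\<not> a + 1 - n < i + m"
      "a + 1 - n + 1 - m = a + 1 - (m + n - 1)"
      using assms eqs by auto
    then show ?thesis unfolding mem by (simp only: if_True if_False)
  qed
qed

lemma com_set_seq:
  assumes "J \<subseteq> {1..m}" "N \<subseteq> {1..n}" "1 \<le> i" "j \<in> {1..m}" "1 \<le> n"
  shows "com_set n (i - 1 + j) (com_set m i I J) N = com_set (m + n - 1) i I (com_set n j J N)"
proof (rule set_eqI)
  fix a
  have JN: "com_set n j J N \<subseteq> {1..m + n - 1}" by (rule com_set_subset) (use assms in auto)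
  have eqs: "1 \<le> m" "1 \<le> i - 1 + j" "1 \<le> j" "1 \<le> m + n - 1" "j \<le> m" using assms by auto
  note mem = mem_com_set[OF eqs(2) assms(5,2)] mem_com_set[OF assms(3) eqs(1) assms(1)]
    mem_com_set[OF assms(3) eqs(4) JN] mem_com_set[OF eqs(3) assms(5,2)]
  have arith: "i - 1 + j + 1 - i = j" "i - 1 + j < i + m" "\<not> i - 1 + j < i" using assms by auto
  consider "a < i" | "i \<le> a" "a < i - 1 + j" | "i - 1 + j \<le> a" "a < i - 1 + j + n"
    | "i - 1 + j + n \<le> a" "a + 1 < i + m + n" | "i + m + n \<le> a + 1" by linarith
  then show "a \<in> com_set n (i - 1 + j) (com_set m i I J) N \<longleftrightarrow>
        a \<in> com_set (m + n - 1) i I (com_set n j J N)"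
  proof cases
    case 1
    then have "a < i - 1 + j" using assms by auto
    with 1 show ?thesis unfolding mem by simp
  next
    case 2
    then have "a < i + m" "a < i + (m + n - 1)" "a + 1 - i < j" "\<not> a < i"
      using assms eqs by auto
    with 2 show ?thesis unfolding mem by simp
  next
    case 3
    then have "\<not> a < i" "a < i + (m + n - 1)" "\<not> a + 1 - i < j" "a + 1 - i < j + n"
      "\<not> a < i - 1 + j" "a + 1 - (i - 1 + j) = a + 1 - i + 1 - j"
      using assms eqs by auto
    with 3 show ?thesis unfolding mem arith by (simp only: if_True if_False arith) blast
  next
    case 4
    then have "\<not> a < i" "a < i + (m + n - 1)" "\<not> a + 1 - i < j" "\<not> a + 1 - i < j + n"
      "\<not> a < i - 1 + j" "\<not> a < i - 1 + j + n" "\<not> a + 1 - n < i" "a + 1 - n < i + m"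
      "a + 1 - n + 1 - i = a + 1 - i + 1 - n"
      using assms eqs by auto
    then show ?thesis unfolding mem by (simp only: if_True if_False)
  next
    case 5
    then have "\<not> a < i" "\<not> a < i + (m + n - 1)"
      "\<not> a < i - 1 + j" "\<not> a < i - 1 + j + n" "\<not> a + 1 - n < i" "\<not> a + 1 - n < i + m"
      "a + 1 - n + 1 - m = a + 1 - (m + n - 1)"
      using assms eqs by auto
    then show ?thesis unfolding mem by (simp only: if_True if_False)
  qed
qed

lemma sub_set_par:
  assumes "J \<subseteq> {1..m}" "N \<subseteq> {1..n}" "1 \<le> i" "i < k" "1 \<le> m" "1 \<le> n"
  shows "sub_set n (k - 1 + m) (sub_set m i I J) N = sub_set m i (sub_set n k I N) J"
proof (rule set_eqI)
  fix a
  have eqs: "1 \<le> k - 1 + m" "1 \<le> k" using assms by auto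
  note mem = mem_sub_set[OF eqs(1) assms(6,2)] mem_sub_set[OF assms(3,5,1)]
    mem_sub_set[OF eqs(2) assms(6,2)]
  have arith: "k - 1 + m + 1 - m = k" "\<not> k - 1 + m < i" "\<not> k - 1 + m < i + m" "i < k"
    using assms by auto
  consider "a < i" | "i \<le> a" "a < i + m" | "i + m \<le> a" "a < k - 1 + m"
    | "k - 1 + m \<le> a" "a < k - 1 + m + n" | "k - 1 + m + n \<le> a" by linarith
  then show "a \<in> sub_set n (k - 1 + m) (sub_set m i I J) N \<longleftrightarrow>
        a \<in> sub_set m i (sub_set n k I N) J"
  proof cases
    case 1
    then have "a < k - 1 + m" "a < k" using assms by auto
    with 1 show ?thesis unfolding mem by simp
  next
    case 2
    then have "a < k - 1 + m" "\<not> a < i" using assms by auto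
    with 2 show ?thesis unfolding mem by (simp only: if_True if_False arith)
  next
    case 3
    then have "\<not> a < i + m" "\<not> a < i" "a + 1 - m < k" using assms by auto
    with 3 show ?thesis unfolding mem by (simp only: if_True if_False arith)
  next
    case 4
    then have "\<not> a < i + m" "\<not> a < i" "\<not> a + 1 - m < k" "\<not> a < k - 1 + m" "a + 1 - m < k + n"
      "a + 1 - (k - 1 + m) = a + 1 - m + 1 - k"
      using assms by auto
    with 4 show ?thesis unfolding mem by (simp only: if_True if_False arith)
  next
    case 5
    then have "\<not> a < i + m" "\<not> a < i" "\<not> a + 1 - m < k" "\<not> a < k - 1 + m" "\<not> a + 1 - m < k + n"
      "\<not> a < k - 1 + m + n" "\<not> a + 1 - n < i" "\<not> a + 1 - n < i + m"
      "a + 1 - m + 1 - n = a + 1 - n + 1 - m"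
      using assms by auto
    then show ?thesis unfolding mem by (simp only: if_True if_False)
  qed
qed

lemma com_set_par:
  assumes "J \<subseteq> {1..m}" "N \<subseteq> {1..n}" "1 \<le> i" "i < k" "1 \<le> m" "1 \<le> n"
  shows "com_set n (k - 1 + m) (com_set m i I J) N = com_set m i (com_set n k I N) J"
proof (rule set_eqI)
  fix a
  have eqs: "1 \<le> k - 1 + m" "1 \<le> k" using assms by auto
  note mem = mem_com_set[OF eqs(1) assms(6,2)] mem_com_set[OF assms(3,5,1)]
    mem_com_set[OF eqs(2) assms(6,2)]
  have arith: "k - 1 + m + 1 - m = k" "\<not> k - 1 + m < i" "\<not> k - 1 + m < i + m" "i < k"
    using assms by auto
  consider "a < i" | "i \<le> a" "a < i + m" | "i + m \<le> a" "a < k - 1 + m"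
    | "k - 1 + m \<le> a" "a < k - 1 + m + n" | "k - 1 + m + n \<le> a" by linarith
  then show "a \<in> com_set n (k - 1 + m) (com_set m i I J) N \<longleftrightarrow>
        a \<in> com_set m i (com_set n k I N) J"
  proof cases
    case 1
    then have "a < k - 1 + m" "a < k" using assms by auto
    with 1 show ?thesis unfolding mem by simp
  next
    case 2
    then have "a < k - 1 + m" "\<not> a < i" using assms by auto
    with 2 show ?thesis unfolding mem by (simp only: if_True if_False arith)
  next
    case 3
    then have "\<not> a < i + m" "\<not> a < i" "a + 1 - m < k" using assms by auto
    with 3 show ?thesis unfolding mem by (simp only: if_True if_False arith)
  next
    case 4
    then have "\<not> a < i + m" "\<not> a < i" "\<not> a + 1 - m < k" "\<not> a < k - 1 + m" "a + 1 - m < k + n"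
      "a + 1 - (k - 1 + m) = a + 1 - m + 1 - k"
      using assms by auto
    with 4 show ?thesis unfolding mem by (simp only: if_True if_False arith)
  next
    case 5
    then have "\<not> a < i + m" "\<not> a < i" "\<not> a + 1 - m < k" "\<not> a < k - 1 + m" "\<not> a + 1 - m < k + n"
      "\<not> a < k - 1 + m + n" "\<not> a + 1 - n < i" "\<not> a + 1 - n < i + m"
      "a + 1 - m + 1 - n = a + 1 - n + 1 - m"
      using assms by auto
    then show ?thesis unfolding mem by (simp only: if_True if_False)
  qed
qed

lemma sub_set_altdef:
  "sub_set m k I J = shift m k ` (I - {k}) \<union> (if k \<in> I then (\<lambda>j. j + k - 1) ` J else {})"
proof -
  have "shift m k ` (I - {k}) = {i \<in> I. i < k} \<union> (\<lambda>i. i + m - 1) ` {i \<in> I. i > k}"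
    unfolding shift_def by (auto simp: image_iff not_less le_less)
  then show ?thesis unfolding sub_set_def by auto
qed

lemma com_set_altdef:
  "com_set m k I J = shift m k ` (I - {k}) \<union> (\<lambda>j. j + k - 1) ` (if k \<in> I then {1..m} else J)"
proof -
  have "shift m k ` (I - {k}) = {i \<in> I. i < k} \<union> (\<lambda>i. i + m - 1) ` {i \<in> I. i > k}"
    unfolding shift_def by (auto simp: image_iff not_less le_less)
  then show ?thesis unfolding com_set_def by auto
qed

lemma block_perm_shift:
  assumes "1 \<le> m" "a \<noteq> k"
  shows "block_perm m k \<sigma> \<tau> (shift m k a) = shift m (\<sigma> k) (\<sigma> a)"
proof -
  have "a + m - 1 - m + 1 = a" if "k < a" using that assms by auto
  then show ?thesis using assms unfolding block_perm_def by (auto simp: shift_def)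
qed

lemma block_perm_block:
  assumes "1 \<le> k" "1 \<le> \<sigma> k" "j \<in> {1..m}"
  shows "block_perm m k \<sigma> \<tau> (j + k - 1) = \<tau> j + \<sigma> k - 1"
proof -
  have "j + k - 1 - k + 1 = j" using assms by auto
  then show ?thesis using assms unfolding block_perm_def by auto
qed

lemma image_shift_block:
  assumes "\<sigma> permutes {1..n}" "k \<in> {1..n}" "1 \<le> m" "J \<subseteq> {1..m}"
  shows "block_perm m k \<sigma> \<tau> ` shift m k ` (I - {k}) = shift m (\<sigma> k) ` (\<sigma> ` I - {\<sigma> k})"
    and "block_perm m k \<sigma> \<tau> ` (\<lambda>j. j + k - 1) ` J = (\<lambda>j. j + \<sigma> k - 1) ` \<tau> ` J"
proof -
  have "\<sigma> ` I - {\<sigma> k} = \<sigma> ` (I - {k})"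
    using permutes_inj[OF assms(1)] by (auto simp: inj_eq)
  then show "block_perm m k \<sigma> \<tau> ` shift m k ` (I - {k}) = shift m (\<sigma> k) ` (\<sigma> ` I - {\<sigma> k})"
    using block_perm_shift[OF assms(3), of _ k \<sigma> \<tau>] by (auto simp: image_iff)
  have "1 \<le> \<sigma> k" "1 \<le> k" using permutes_in_image[OF assms(1), of k] assms(2) by auto
  then show "block_perm m k \<sigma> \<tau> ` (\<lambda>j. j + k - 1) ` J = (\<lambda>j. j + \<sigma> k - 1) ` \<tau> ` J"
    unfolding image_image using assms(4)
    by (intro image_cong refl block_perm_block) auto
qed

lemma sub_set_equivariant:
  assumes "\<sigma> permutes {1..n}" "k \<in> {1..n}" "1 \<le> m" "J \<subseteq> {1..m}"
  shows "sub_set m (\<sigma> k) (\<sigma> ` I) (\<tau> ` J) = block_perm m k \<sigma> \<tau> ` sub_set m k I J"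
proof -
  have "\<sigma> k \<in> \<sigma> ` I \<longleftrightarrow> k \<in> I" using permutes_inj[OF assms(1)] by (auto simp: inj_eq)
  then show ?thesis
    using image_shift_block(1)[OF assms, of \<tau> I] image_shift_block(2)[OF assms, of \<tau>]
    unfolding sub_set_altdef image_Un by (cases "k \<in> I") simp_all
qed

lemma com_set_equivariant:
  assumes "\<sigma> permutes {1..n}" "\<tau> permutes {1..m}" "k \<in> {1..n}" "1 \<le> m" "J \<subseteq> {1..m}"
  shows "com_set m (\<sigma> k) (\<sigma> ` I) (\<tau> ` J) = block_perm m k \<sigma> \<tau> ` com_set m k I J"
proof -
  define J' where "J' = (if k \<in> I then {1..m} else J)"
  have J': "J' \<subseteq> {1..m}" using assms by (auto simp: J'_def)
  have "\<sigma> k \<in> \<sigma> ` I \<longleftrightarrow> k \<in> I" using permutes_inj[OF assms(1)] by (auto simp: inj_eq)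
  then have "(if \<sigma> k \<in> \<sigma> ` I then {1..m} else \<tau> ` J) = \<tau> ` J'"
    using permutes_image[OF assms(2)] by (simp add: J'_def)
  then show ?thesis
    using image_shift_block(1)[OF assms(1,3,4) J', of \<tau> I]
      image_shift_block(2)[OF assms(1,3,4) J', of \<tau>]
    unfolding com_set_altdef image_Un J'_def[symmetric] by simp
qed

lemma scpxD: "K \<in> scpx n \<Longrightarrow> I \<in> K \<Longrightarrow> I \<subseteq> {1..n}" "K \<in> scpx n \<Longrightarrow> 1 \<le> n"
    "K \<in> scpx n \<Longrightarrow> I \<in> K \<Longrightarrow> J \<subseteq> I \<Longrightarrow> J \<in> K"
  unfolding scpx_def by blast+

lemma sub_comp_closed:
  assumes K: "K \<in> scpx n" and L: "L \<in> scpx m" and k: "k \<in> {1..n}"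
  shows "sub_comp m k K L \<in> scpx (n + m - 1)"
proof -
  have 1: "S \<in> sub_comp m k K L" if IJ: "I \<in> K" "J \<in> L" and S: "S \<subseteq> sub_set m k I J" for I J S
  proof -
    define I' where "I' = {i \<in> I. i = k \<or> shift m k i \<in> S}"
    define J' where "J' = {j \<in> J. j + k - 1 \<in> S}"
    have "I' \<subseteq> I" "J' \<subseteq> J" by (auto simp: I'_def J'_def)
    then have "I' \<in> K" "J' \<in> L" using scpxD(3)[OF K IJ(1)] scpxD(3)[OF L IJ(2)] by blast+
    moreover have "shift m k ` (I' - {k}) = shift m k ` (I - {k}) \<inter> S"
      "(\<lambda>j. j + k - 1) ` J' = (\<lambda>j. j + k - 1) ` J \<inter> S" "k \<in> I' \<longleftrightarrow> k \<in> I"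
      by (auto simp: I'_def J'_def)
    then have "S = sub_set m k I' J'"
      using S unfolding sub_set_altdef by (cases "k \<in> I") auto
    ultimately show ?thesis unfolding sub_comp_def by blast
  qed
  have 2: "sub_set m k I J \<subseteq> {1..n + m - 1}" if "I \<in> K" "J \<in> L" for I J
    by (rule sub_set_subset[OF k scpxD(2)[OF L] scpxD(1)[OF K that(1)] scpxD(1)[OF L that(2)]])
  have "T \<in> sub_comp m k K L" if "S \<in> sub_comp m k K L" "T \<subseteq> S" for S T
    using that 1 unfolding sub_comp_def by blast
  moreover have "S \<subseteq> {1..n + m - 1}" if "S \<in> sub_comp m k K L" for S
    using that 2 unfolding sub_comp_def by blast
  moreover have "1 \<le> n + m - 1" using scpxD(2)[OF K] scpxD(2)[OF L] by simp
  ultimately show ?thesis unfolding scpx_def by blast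
qed

lemma com_comp_closed:
  assumes K: "K \<in> scpx n" and L: "L \<in> scpx m" and k: "k \<in> {1..n}"
  shows "com_comp m k K L \<in> scpx (n + m - 1)"
proof -
  have "com_set m k I J \<subseteq> {1..n + m - 1}" if "I \<in> K" "J \<in> L" for I J
    by (rule com_set_subset[OF k scpxD(2)[OF L] scpxD(1)[OF K that(1)] scpxD(1)[OF L that(2)]])
  then have "S \<subseteq> {1..n + m - 1}" if "S \<in> com_comp m k K L" for S
    using that unfolding com_comp_def by blast
  moreover have "T \<in> com_comp m k K L" if "S \<in> com_comp m k K L" "T \<subseteq> S" for S T
    using that unfolding com_comp_def by blast
  moreover have "1 \<le> n + m - 1" using scpxD(2)[OF K] scpxD(2)[OF L] by simp
  ultimately show ?thesis unfolding scpx_def by blast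
qed

lemma comp_nonempty:
  "sub_comp m k K L \<noteq> {} \<longleftrightarrow> K \<noteq> {} \<and> L \<noteq> {}"
  "com_comp m k K L \<noteq> {} \<longleftrightarrow> K \<noteq> {} \<and> L \<noteq> {}"
  unfolding sub_comp_def com_comp_def by blast+

lemma relabel_altdef: "relabel \<sigma> K = (`) \<sigma> ` K"
  unfolding relabel_def by auto

lemma relabel_closed:
  assumes "\<sigma> permutes {1..n}" "K \<in> scpx n"
  shows "relabel \<sigma> K \<in> scpx n"
proof -
  have "\<sigma> ` I \<subseteq> {1..n}" if "I \<in> K" for I
    using scpxD(1)[OF assms(2) that] permutes_image[OF assms(1)] by blast
  moreover have "J \<in> relabel \<sigma> K" if "I \<in> K" "J \<subseteq> \<sigma> ` I" for I J
  proof -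
    obtain J' where "J' \<subseteq> I" "J = \<sigma> ` J'"
      using \<open>J \<subseteq> \<sigma> ` I\<close> by (auto simp: subset_image_iff)
    then show ?thesis using scpxD(3)[OF assms(2) \<open>I \<in> K\<close>] unfolding relabel_def by blast
  qed
  ultimately show ?thesis
    using scpxD(2)[OF assms(2)] unfolding scpx_def relabel_def by blast
qed

lemma sub_comp_unit_left:
  assumes "K \<in> scpx n"
  shows "sub_comp n 1 {{}, {1}} K = K"
proof -
  have "sub_set n 1 {} J = {}" "sub_set n 1 {1} J = J" for J
    unfolding sub_set_altdef by auto
  moreover have "sub_comp n 1 {{}, {1}} K = (\<Union>J\<in>K. {sub_set n 1 {} J, sub_set n 1 {1} J})"
    unfolding sub_comp_def by blast
  ultimately have "sub_comp n 1 {{}, {1}} K = (\<Union>J\<in>K. {{}, J})"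
    by (simp only:)
  moreover have "{} \<in> K" if "J \<in> K" for J using scpxD(3)[OF assms that] by simp
  ultimately show ?thesis by auto
qed

lemma sub_comp_unit_right:
  assumes "K \<in> scpx n" "k \<in> {1..n}"
  shows "sub_comp 1 k K {{}, {1}} = K"
proof -
  have "shift 1 k = id" unfolding shift_def by auto
  then have "sub_set 1 k I {} = I - {k}" "sub_set 1 k I {1} = I" for I
    unfolding sub_set_altdef by auto
  moreover have "sub_comp 1 k K {{}, {1}} = (\<Union>I\<in>K. {sub_set 1 k I {}, sub_set 1 k I {1}})"
    unfolding sub_comp_def by blast
  ultimately have "sub_comp 1 k K {{}, {1}} = (\<Union>I\<in>K. {I - {k}, I})"
    by (simp only:)
  moreover have "I - {k} \<in> K" if "I \<in> K" for I
    by (rule scpxD(3)[OF assms(1) that]) blast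
  ultimately show ?thesis by auto
qed

lemma com_comp_unit_left:
  assumes "K \<in> scpx n"
  shows "com_comp n 1 {{}} K = K"
proof -
  have "com_set n 1 {} J = J" for J
    unfolding com_set_altdef by auto
  then show ?thesis using scpxD(3)[OF assms] unfolding com_comp_def by auto
qed

lemma com_comp_unit_right:
  assumes "K \<in> scpx n" "k \<in> {1..n}"
  shows "com_comp 1 k K {{}} = K"
proof -
  have "shift 1 k = id" unfolding shift_def by auto
  then have "com_set 1 k I {} = I" for I
    unfolding com_set_altdef by auto
  then show ?thesis using scpxD(3)[OF assms(1)] unfolding com_comp_def by auto
qed

lemma bex_swap: "(\<exists>x\<in>A. \<exists>y\<in>B. P x y) \<longleftrightarrow> (\<exists>y\<in>B. \<exists>x\<in>A. P x y)"
  by blast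

lemma sub_comp_assoc:
  "sub_comp n p (sub_comp m i K L) M =
     {S. \<exists>I\<in>K. \<exists>J\<in>L. \<exists>N\<in>M. S = sub_set n p (sub_set m i I J) N}"
  "sub_comp n p K (sub_comp m i L M) =
     {S. \<exists>I\<in>K. \<exists>J\<in>L. \<exists>N\<in>M. S = sub_set n p I (sub_set m i J N)}"
  unfolding sub_comp_def by blast+

lemma com_comp_assoc:
  assumes "K \<in> scpx l" "L \<in> scpx m" "M \<in> scpx n" "i \<in> {1..l}" "1 \<le> p"
  shows "com_comp n p (com_comp m i K L) M =
           {S. \<exists>I\<in>K. \<exists>J\<in>L. \<exists>N\<in>M. S \<subseteq> com_set n p (com_set m i I J) N}"
proof -
  have mono: "com_set n p S N \<subseteq> com_set n p (com_set m i I J) N"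
    if "N \<in> M" "S \<subseteq> com_set m i I J" for I J N S
    using com_set_mono[OF assms(5) scpxD(2)[OF assms(3)] that(2) subset_refl
        scpxD(1)[OF assms(3) that(1)]] .
  show ?thesis
  proof (intro set_eqI iffI)
    fix S assume "S \<in> com_comp n p (com_comp m i K L) M"
    then obtain T I J N where "I \<in> K" "J \<in> L" "N \<in> M" "T \<subseteq> com_set m i I J" "S \<subseteq> com_set n p T N"
      unfolding com_comp_def by auto
    then show "S \<in> {S. \<exists>I\<in>K. \<exists>J\<in>L. \<exists>N\<in>M. S \<subseteq> com_set n p (com_set m i I J) N}"
      using mono by blast
  qed (auto simp: com_comp_def)
qed

lemma com_comp_assoc':
  assumes "L \<in> scpx m" "M \<in> scpx n" "1 \<le> i" "j \<in> {1..m}"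
  shows "com_comp (m + n - 1) i K (com_comp n j L M) =
           {S. \<exists>I\<in>K. \<exists>J\<in>L. \<exists>N\<in>M. S \<subseteq> com_set (m + n - 1) i I (com_set n j J N)}"
proof -
  have mono: "com_set (m + n - 1) i I S \<subseteq> com_set (m + n - 1) i I (com_set n j J N)"
    if "J \<in> L" "N \<in> M" "S \<subseteq> com_set n j J N" for I J N S
    by (rule com_set_mono[OF assms(3) _ subset_refl that(3)])
      (use assms com_set_subset[OF assms(4) scpxD(2)[OF assms(2)] scpxD(1)[OF assms(1) that(1)]
        scpxD(1)[OF assms(2) that(2)]] scpxD(2)[OF assms(2)] in auto)
  show ?thesis
  proof (intro set_eqI iffI)
    fix S assume "S \<in> com_comp (m + n - 1) i K (com_comp n j L M)"
    then obtain T I J N where "I \<in> K" "J \<in> L" "N \<in> M" "T \<subseteq> com_set n j J N"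
        "S \<subseteq> com_set (m + n - 1) i I T"
      unfolding com_comp_def by auto
    then show "S \<in> {S. \<exists>I\<in>K. \<exists>J\<in>L. \<exists>N\<in>M. S \<subseteq> com_set (m + n - 1) i I (com_set n j J N)}"
      using mono by blast
  qed (auto simp: com_comp_def)
qed

lemma sub_operad: 
  assumes "C = scpx \<or> C = scpx_nonempty"
  shows "symmetric_operad (substitution_operad\<lparr>ops := C\<rparr>)"
proof -
  have C: "x \<in> C n \<Longrightarrow> x \<in> scpx n" for x n using assms by (auto simp: scpx_nonempty_def)
  show ?thesis
  proof (unfold_locales; (unfold substitution_operad_def operad.simps)?)
    show "C 0 = {}" using assms by (auto simp: scpx_def scpx_nonempty_def)
    show "{{}, {1}} \<in> C 1" using assms by (auto simp: scpx_def scpx_nonempty_def)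
  next
    fix \<sigma> :: "nat \<Rightarrow> nat" and n K assume "\<sigma> permutes {1..n}" "K \<in> C n"
    then show "relabel \<sigma> K \<in> C n"
      using relabel_closed[OF _ C] assms by (auto simp: scpx_nonempty_def relabel_altdef)
  next
    fix K L n m k assume "K \<in> C n" "L \<in> C m" "k \<in> {1..n}"
    then show "sub_comp m k K L \<in> C (n + m - 1)"
      using sub_comp_closed[OF C C] assms by (auto simp: scpx_nonempty_def comp_nonempty)
  next
    fix K n assume "K \<in> C n"
    then show "relabel id K = K" "sub_comp n 1 {{}, {1}} K = K"
      using sub_comp_unit_left[OF C] by (auto simp: relabel_altdef)
  next
    fix \<sigma> \<tau> :: "nat \<Rightarrow> nat" and K
    show "relabel (\<sigma> \<circ> \<tau>) K = relabel \<sigma> (relabel \<tau> K)"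
      by (simp add: relabel_altdef image_image image_comp)
  next
    fix K n k assume "K \<in> C n" "k \<in> {1..n}"
    then show "sub_comp 1 k K {{}, {1}} = K" using sub_comp_unit_right[OF C] by blast
  next
    fix K L M l m n i j
    assume *: "K \<in> C l" "L \<in> C m" "M \<in> C n" "i \<in> {1..l}" "j \<in> {1..m}"
    have "sub_set n (i - 1 + j) (sub_set m i I J) N = sub_set (m + n - 1) i I (sub_set n j J N)"
      if "I \<in> K" "J \<in> L" "N \<in> M" for I J N
      by (rule sub_set_seq[OF scpxD(1)[OF C[OF *(2)] that(2)] scpxD(1)[OF C[OF *(3)] that(3)]
            _ *(5) scpxD(2)[OF C[OF *(3)]]]) (use * in simp)
    then show "sub_comp n (i - 1 + j) (sub_comp m i K L) M
        = sub_comp (m + n - 1) i K (sub_comp n j L M)"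
      unfolding sub_comp_assoc by (intro Collect_cong bex_cong refl) simp
  next
    fix K L M l m n i k
    assume *: "K \<in> C l" "L \<in> C m" "M \<in> C n" "i \<in> {1..l}" "k \<in> {1..l}" "i < k"
    have "sub_set n (k - 1 + m) (sub_set m i I J) N = sub_set m i (sub_set n k I N) J"
      if "I \<in> K" "J \<in> L" "N \<in> M" for I J N
      by (rule sub_set_par[OF scpxD(1)[OF C[OF *(2)] that(2)] scpxD(1)[OF C[OF *(3)] that(3)]
            _ *(6) scpxD(2)[OF C[OF *(2)]] scpxD(2)[OF C[OF *(3)]]]) (use * in simp)
    then show "sub_comp n (k - 1 + m) (sub_comp m i K L) M = sub_comp m i (sub_comp n k K M) L"
      unfolding sub_comp_assoc bex_swap[of L M] by (intro Collect_cong bex_cong refl) simp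
  next
    fix K L n m k and \<sigma> \<tau> :: "nat \<Rightarrow> nat"
    assume *: "K \<in> C n" "L \<in> C m" "k \<in> {1..n}" "\<sigma> permutes {1..n}" "\<tau> permutes {1..m}"
    have eq: "sub_set m (\<sigma> k) (\<sigma> ` I) (\<tau> ` J) = block_perm m k \<sigma> \<tau> ` sub_set m k I J"
      if "I \<in> K" "J \<in> L" for I J
      by (rule sub_set_equivariant[OF *(4) *(3) scpxD(2)[OF C[OF *(2)]]
            scpxD(1)[OF C[OF *(2)] that(2)]])
    have "sub_comp m (\<sigma> k) (relabel \<sigma> K) (relabel \<tau> L) =
        {S. \<exists>I\<in>K. \<exists>J\<in>L. S = sub_set m (\<sigma> k) (\<sigma> ` I) (\<tau> ` J)}"
      unfolding sub_comp_def relabel_def by blast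
    also have "\<dots> = {S. \<exists>I\<in>K. \<exists>J\<in>L. S = block_perm m k \<sigma> \<tau> ` sub_set m k I J}"
      by (intro Collect_cong bex_cong refl) (simp add: eq)
    also have "\<dots> = relabel (block_perm m k \<sigma> \<tau>) (sub_comp m k K L)"
      unfolding sub_comp_def relabel_def by blast
    finally show "sub_comp m (\<sigma> k) (relabel \<sigma> K) (relabel \<tau> L)
        = relabel (block_perm m k \<sigma> \<tau>) (sub_comp m k K L)" .
  qed
qed

lemma com_operad:
  assumes "C = scpx \<or> C = scpx_nonempty"
  shows "symmetric_operad (composition_operad\<lparr>ops := C\<rparr>)"
proof -
  have C: "x \<in> C n \<Longrightarrow> x \<in> scpx n" for x n using assms by (auto simp: scpx_nonempty_def)
  show ?thesis
  proof (unfold_locales; (unfold composition_operad_def operad.simps)?)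
    show "C 0 = {}" using assms by (auto simp: scpx_def scpx_nonempty_def)
    show "{{}} \<in> C 1" using assms by (auto simp: scpx_def scpx_nonempty_def)
  next
    fix \<sigma> :: "nat \<Rightarrow> nat" and n K assume "\<sigma> permutes {1..n}" "K \<in> C n"
    then show "relabel \<sigma> K \<in> C n"
      using relabel_closed[OF _ C] assms by (auto simp: scpx_nonempty_def relabel_altdef)
  next
    fix K L n m k assume "K \<in> C n" "L \<in> C m" "k \<in> {1..n}"
    then show "com_comp m k K L \<in> C (n + m - 1)"
      using com_comp_closed[OF C C] assms by (auto simp: scpx_nonempty_def comp_nonempty)
  next
    fix K n assume "K \<in> C n"
    then show "relabel id K = K" "com_comp n 1 {{}} K = K"
      using com_comp_unit_left[OF C] by (auto simp: relabel_altdef)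
  next
    fix \<sigma> \<tau> :: "nat \<Rightarrow> nat" and K
    show "relabel (\<sigma> \<circ> \<tau>) K = relabel \<sigma> (relabel \<tau> K)"
      by (simp add: relabel_altdef image_image image_comp)
  next
    fix K n k assume "K \<in> C n" "k \<in> {1..n}"
    then show "com_comp 1 k K {{}} = K" using com_comp_unit_right[OF C] by blast
  next
    fix K L M l m n i j
    assume *: "K \<in> C l" "L \<in> C m" "M \<in> C n" "i \<in> {1..l}" "j \<in> {1..m}"
    have eq: "com_set n (i - 1 + j) (com_set m i I J) N = com_set (m + n - 1) i I (com_set n j J N)"
      if "I \<in> K" "J \<in> L" "N \<in> M" for I J N
      by (rule com_set_seq[OF scpxD(1)[OF C[OF *(2)] that(2)] scpxD(1)[OF C[OF *(3)] that(3)]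
            _ *(5) scpxD(2)[OF C[OF *(3)]]]) (use * in simp)
    have ij: "1 \<le> i - 1 + j" "1 \<le> i" using * by auto
    show "com_comp n (i - 1 + j) (com_comp m i K L) M
        = com_comp (m + n - 1) i K (com_comp n j L M)"
      unfolding com_comp_assoc[OF *(1-3)[THEN C] *(4) ij(1)]
        com_comp_assoc'[OF *(2,3)[THEN C] ij(2) *(5)]
      by (intro Collect_cong bex_cong refl) (simp only: eq)
  next
    fix K L M l m n i k
    assume *: "K \<in> C l" "L \<in> C m" "M \<in> C n" "i \<in> {1..l}" "k \<in> {1..l}" "i < k"
    have eq: "com_set n (k - 1 + m) (com_set m i I J) N = com_set m i (com_set n k I N) J"
      if "I \<in> K" "J \<in> L" "N \<in> M" for I J N
      by (rule com_set_par[OF scpxD(1)[OF C[OF *(2)] that(2)] scpxD(1)[OF C[OF *(3)] that(3)]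
            _ *(6) scpxD(2)[OF C[OF *(2)]] scpxD(2)[OF C[OF *(3)]]]) (use * in simp)
    have ik: "1 \<le> k - 1 + m" "1 \<le> i" using * by auto
    show "com_comp n (k - 1 + m) (com_comp m i K L) M = com_comp m i (com_comp n k K M) L"
      unfolding com_comp_assoc[OF *(1-3)[THEN C] *(4) ik(1)]
        com_comp_assoc[OF *(1,3,2)[THEN C] *(5) ik(2)] bex_swap[of L M]
      by (intro Collect_cong bex_cong refl) (simp only: eq)
  next
    fix K L n m k and \<sigma> \<tau> :: "nat \<Rightarrow> nat"
    assume *: "K \<in> C n" "L \<in> C m" "k \<in> {1..n}" "\<sigma> permutes {1..n}" "\<tau> permutes {1..m}"
    have eq: "com_set m (\<sigma> k) (\<sigma> ` I) (\<tau> ` J) = block_perm m k \<sigma> \<tau> ` com_set m k I J"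
      if "I \<in> K" "J \<in> L" for I J
      by (rule com_set_equivariant[OF *(4,5,3) scpxD(2)[OF C[OF *(2)]]
            scpxD(1)[OF C[OF *(2)] that(2)]])
    show "com_comp m (\<sigma> k) (relabel \<sigma> K) (relabel \<tau> L)
        = relabel (block_perm m k \<sigma> \<tau>) (com_comp m k K L)"
    proof (rule set_eqI)
      fix S
      have "S \<in> com_comp m (\<sigma> k) (relabel \<sigma> K) (relabel \<tau> L) \<longleftrightarrow>
          (\<exists>I\<in>K. \<exists>J\<in>L. S \<subseteq> com_set m (\<sigma> k) (\<sigma> ` I) (\<tau> ` J))"
        unfolding com_comp_def relabel_def by blast
      also have "\<dots> \<longleftrightarrow> (\<exists>I\<in>K. \<exists>J\<in>L. S \<subseteq> block_perm m k \<sigma> \<tau> ` com_set m k I J)"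
        using eq by simp
      also have "\<dots> \<longleftrightarrow> S \<in> relabel (block_perm m k \<sigma> \<tau>) (com_comp m k K L)"
        unfolding com_comp_def relabel_altdef subset_image_iff by blast
      finally show "S \<in> com_comp m (\<sigma> k) (relabel \<sigma> K) (relabel \<tau> L) \<longleftrightarrow>
          S \<in> relabel (block_perm m k \<sigma> \<tau>) (com_comp m k K L)" .
    qed
  qed
qed

theorem symmetric_operads:
  "symmetric_operad substitution_operad"
  "symmetric_operad substitution_operad_nonempty"
  "symmetric_operad composition_operad"
  "symmetric_operad composition_operad_nonempty"
  using sub_operad[of scpx] sub_operad[of scpx_nonempty]
    com_operad[of scpx] com_operad[of scpx_nonempty]
  by (simp_all add: substitution_operad_def substitution_operad_nonempty_def
      composition_operad_def composition_operad_nonempty_def)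

lemma block_perm_permutes:
  assumes "\<sigma> permutes {1..n}" "\<tau> permutes {1..m}" "k \<in> {1..n}" "1 \<le> m"
  shows "block_perm m k \<sigma> \<tau> permutes {1..n + m - 1}"
proof -
  have full: "sub_set m a {1..n} {1..m} = {1..n + m - 1}" if "a \<in> {1..n}" for a
    using that assms(4)
    by (intro set_eqI, subst mem_sub_set) auto
  have "\<sigma> k \<in> {1..n}" using permutes_in_image[OF assms(1)] assms(3) by blast
  then have im: "block_perm m k \<sigma> \<tau> ` {1..n + m - 1} = {1..n + m - 1}"
    using sub_set_equivariant[OF assms(1,3,4) subset_refl, where I = "{1..n}" and \<tau> = \<tau>]
      full assms(3) permutes_image[OF assms(1)] permutes_image[OF assms(2)] by simp
  then have "bij_betw (block_perm m k \<sigma> \<tau>) {1..n + m - 1} {1..n + m - 1}"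
    by (simp add: bij_betw_def eq_card_imp_inj_on)
  moreover have "block_perm m k \<sigma> \<tau> i = i" if "i \<notin> {1..n + m - 1}" for i
  proof (cases "i = 0")
    case True
    then show ?thesis
      using \<open>\<sigma> k \<in> _\<close> assms(3) permutes_not_in[OF assms(1), of 0]
      by (simp add: block_perm_def shift_def)
  next
    case False
    then have "i \<ge> n + m" using that by auto
    then show ?thesis
      using \<open>\<sigma> k \<in> _\<close> assms(3,4) permutes_not_in[OF assms(1), of "i - m + 1"]
      by (auto simp: block_perm_def shift_def)
  qed
  ultimately show ?thesis by (rule bij_imp_permutes)
qed

end

theory Submission imports Defs begin

text \<open>
  Call an operation of an operad prime if it is a composite \<open>x \<circ>\<^sub>k y\<close> only trivially, namely
  when it already equals one of the two factors. A prime operation that is fixed by relabelling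
  and differs from the unit belongs to every generating set, because relabelling and composing
  other operations never produces it. So an operad that has such an operation in every large
  arity is not finitely generated (\<open>not_finitely_generatedI\<close>).

  Skeleta of simplices are fixed by relabelling, and the right choice of dimension makes them
  prime. For the substitution operad it is the family of sets with at most two elements: in a
  composite, two faces that meet the block of the inner complex may exchange their parts in the
  block, so an edge leaving the block and an edge inside the block would produce a triangle
  (\<open>skeleton_2_sub_prime\<close>). For the composition operad it is the family of sets with at most
  one element: the block has at least two elements and so is not a face, hence the composite
  is a join, and a vertex in the block and a vertex outside it would span an edge
  (\<open>skeleton_1_com_prime\<close>). Neither argument excludes compositions with unary operations. These
  are finitely many, and only the unit can produce the skeleton.
\<close>

section \<open>Prime operations obstruct finite generation\<close>

text \<open>
  Induction over the generated operations shows that \<open>b n\<close> is never reached once \<open>n\<close> exceeds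
  the arities of the generators. The trivial decompositions allowed by \<open>prime\<close> have the same
  arity as the factor that equals \<open>b\<close>, so the bound on the arity passes to that factor.
\<close>

lemma not_finitely_generatedI:
  fixes P :: "'a operad" and b :: "nat \<Rightarrow> 'a"
  assumes mem: "\<And>n. N \<le> n \<Longrightarrow> b n \<in> ops P n"
    and act: "\<And>n \<sigma> x. \<lbrakk>\<sigma> permutes {1..n}; act P n \<sigma> x = b n\<rbrakk> \<Longrightarrow> x = b n"
    and prime: "\<And>n m k x y. \<lbrakk>x \<in> ops P n; y \<in> ops P m; k \<in> {1..n}; N \<le> n + m - 1;
      pcomp P n m k x y = b (n + m - 1)\<rbrakk> \<Longrightarrow> m = 1 \<and> x = b n \<or> n = 1 \<and> y = b m"
    and "2 \<le> N"
  shows "\<not> finitely_generated P"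
proof
  assume "finitely_generated P"
  then obtain X where X: "finite X" "generated P X = operations P"
    unfolding finitely_generated_def by blast
  define M where "M = Suc (Max (insert N (fst ` X)))"
  have M: "n < M" if "(n, x) \<in> X" for n x
    using that X(1) unfolding M_def by (force simp: less_Suc_eq_le intro: Max_ge)
  have "N \<le> M"
    using X(1) unfolding M_def by (simp add: le_SucI)
  have unreachable: "M \<le> n \<Longrightarrow> x \<noteq> b n" if "(n, x) \<in> generated P X" for n x
    using that
  proof (induction rule: generated.induct)
    case (gen n x)
    then show ?case using M by fastforce
  next
    case unit
    then show ?case using \<open>N \<le> M\<close> \<open>2 \<le> N\<close> by simp
  next
    case (act n x \<sigma>)
    then show ?case using assms(2) by fastforce
  next
    case (comp n x m y k)
    then have "x \<in> ops P n" "y \<in> ops P m"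
      using X(2) by (auto simp: operations_def)
    then show ?case
      using prime[of x n y m k] comp \<open>N \<le> M\<close> by fastforce
  qed
  have "(M, b M) \<in> generated P X"
    using mem[OF \<open>N \<le> M\<close>] X(2) by (simp add: operations_def)
  from unreachable[OF this] show False by simp
qed


section \<open>Skeleta of simplices\<close>

text \<open>
  For \<open>1 \<le> r\<close>, this is the skeleton of dimension \<open>r - 1\<close> of the simplex on \<open>n\<close> vertices.
\<close>

definition skeleton :: "nat \<Rightarrow> nat \<Rightarrow> nat set set" where
  "skeleton r n = {S. S \<subseteq> {1..n} \<and> card S \<le> r}"

lemma skeleton_in_scpx_nonempty: "1 \<le> n \<Longrightarrow> skeleton r n \<in> scpx_nonempty n"
proof -
  have "card J \<le> r" if "I \<subseteq> {1..n}" "card I \<le> r" "J \<subseteq> I" for I J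
    using card_mono[OF finite_subset[OF that(1) finite_atLeastAtMost] that(3)] that(2) by simp
  moreover have "{} \<in> skeleton r n" by (simp add: skeleton_def)
  moreover assume "1 \<le> n"
  ultimately show ?thesis
    unfolding scpx_nonempty_def scpx_def skeleton_def by blast
qed

lemma relabel_skeleton:
  assumes "\<sigma> permutes {1..n}"
  shows "relabel \<sigma> (skeleton r n) = skeleton r n"
proof -
  have sub: "relabel \<tau> (skeleton r n) \<subseteq> skeleton r n" if "\<tau> permutes {1..n}" for \<tau>
    using permutes_image[OF that] permutes_inj[OF that]
    by (auto simp: relabel_def skeleton_def card_image inj_on_subset)
  have "S \<in> relabel \<sigma> (skeleton r n)" if "S \<in> skeleton r n" for S
  proof -
    have "inv \<sigma> ` S \<in> skeleton r n"
      using sub[OF permutes_inv[OF assms]] that by (auto simp: relabel_def)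
    moreover have "S = \<sigma> ` inv \<sigma> ` S"
      using permutes_surj[OF assms] by (simp add: image_f_inv_f)
    ultimately show ?thesis unfolding relabel_def by blast
  qed
  with sub[OF assms] show ?thesis by blast
qed

lemma relabel_eq_skeletonD:
  assumes "\<sigma> permutes {1..n}" "relabel \<sigma> K = skeleton r n"
  shows "K = skeleton r n"
proof -
  have "inj ((`) \<sigma>)"
    using permutes_inj[OF assms(1)] by (auto intro!: injI simp: inj_image_eq_iff)
  moreover have "relabel \<sigma> K = relabel \<sigma> (skeleton r n)"
    using assms by (simp add: relabel_skeleton)
  ultimately show ?thesis
    unfolding relabel_altdef by (simp add: inj_image_eq_iff)
qed

lemma scpx_1_cases:
  assumes "K \<in> scpx 1" "K \<noteq> {}"
  obtains "K = {{}}" | "K = {{}, {1}}"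
proof -
  have "{} \<in> K" using assms scpxD(3) by blast
  moreover have "K \<subseteq> {{}, {1}}"
    using scpxD(1)[OF assms(1)] by auto
  ultimately show ?thesis using that by blast
qed

lemma ex_outside_block:
  fixes k n m :: nat
  assumes "k \<in> {1..n}" "2 \<le> n"
  obtains a where "a \<in> {1..n + m - 1}" "a \<notin> {k..<k + m}"
proof (cases "k = 1")
  case True
  then show ?thesis using assms that[of "m + 1"] by auto
next
  case False
  then show ?thesis using assms that[of 1] by auto
qed


section \<open>A prime complex for substitution\<close>

text \<open>
  Two faces \<open>I \<circ>\<^sub>k J\<close> and \<open>I' \<circ>\<^sub>k J'\<close> that meet the block satisfy \<open>k \<in> I\<close> and \<open>k \<in> I'\<close>;
  the exchange of their parts in the block is \<open>I \<circ>\<^sub>k J'\<close>.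
\<close>

lemma sub_comp_exchange:
  assumes K: "K \<in> scpx n" and L: "L \<in> scpx m" and k: "k \<in> {1..n}"
    and S: "S \<in> sub_comp m k K L" "S \<inter> {k..<k + m} \<noteq> {}"
    and T: "T \<in> sub_comp m k K L" "T \<inter> {k..<k + m} \<noteq> {}"
  shows "(S - {k..<k + m}) \<union> (T \<inter> {k..<k + m}) \<in> sub_comp m k K L"
proof -
  obtain I J I' J' where *: "I \<in> K" "J \<in> L" "S = sub_set m k I J"
      "I' \<in> K" "J' \<in> L" "T = sub_set m k I' J'"
    using S(1) T(1) unfolding sub_comp_def by blast
  have km: "1 \<le> k" "1 \<le> m" using k scpxD(2)[OF L] by auto
  note mem = mem_sub_set[OF km scpxD(1)[OF L]]
  have "k \<in> I" "k \<in> I'"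
    using S(2) T(2) * by (auto simp: mem)
  then have "(S - {k..<k + m}) \<union> (T \<inter> {k..<k + m}) = sub_set m k I J'"
    using * by (intro set_eqI) (auto simp: mem)
  then show ?thesis using * unfolding sub_comp_def by blast
qed

lemma skeleton_2_sub_prime:
  assumes K: "K \<in> scpx n" and L: "L \<in> scpx m" and k: "k \<in> {1..n}" and "3 \<le> n + m - 1"
    and eq: "sub_comp m k K L = skeleton 2 (n + m - 1)"
  shows "m = 1 \<and> K = skeleton 2 n \<or> n = 1 \<and> L = skeleton 2 m"
proof -
  have km: "1 \<le> k" "1 \<le> m" "1 \<le> n" using k scpxD(2)[OF L] by auto
  have "{k} \<in> sub_comp m k K L"
    unfolding eq skeleton_def using k km by auto
  then obtain I J where IJ: "I \<in> K" "J \<in> L" "{k} = sub_set m k I J"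
    unfolding sub_comp_def by blast
  \<comment> \<open>As \<open>k\<close> is a vertex of the composite, neither factor can be \<open>{{}}\<close> when it is unary.\<close>
  from IJ(3) have vertex: "k \<in> I" "1 \<in> J"
    using mem_sub_set[OF km(1,2) scpxD(1)[OF L IJ(2)], of k I] km by auto
  consider "m = 1" | "n = 1" | "2 \<le> n" "2 \<le> m" using km by linarith
  then show ?thesis
  proof cases
    case 1
    then have "L = {{}, {1}}"
      using scpx_1_cases[of L] L IJ(2) vertex(2) by auto
    then show ?thesis
      using sub_comp_unit_right[OF K k] eq 1 by simp
  next
    case 2
    then have "k = 1" "K = {{}, {1}}"
      using scpx_1_cases[of K] K k IJ(1) vertex(1) by auto
    then show ?thesis
      using sub_comp_unit_left[OF L] eq 2 by simp
  next
    case 3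
    obtain a where a: "a \<in> {1..n + m - 1}" "a \<notin> {k..<k + m}"
      using ex_outside_block[OF k 3(1)] .
    have "a \<noteq> k" "a \<noteq> k + 1" using a(2) 3(2) by auto
    have "{a, k} \<in> sub_comp m k K L" "{k, k + 1} \<in> sub_comp m k K L"
      unfolding eq skeleton_def using a(1) k 3 by (auto simp: card_insert_if)
    then have "({a, k} - {k..<k + m}) \<union> ({k, k + 1} \<inter> {k..<k + m}) \<in> sub_comp m k K L"
      using 3(2) by (intro sub_comp_exchange[OF K L k]) auto
    moreover have "({a, k} - {k..<k + m}) \<union> ({k, k + 1} \<inter> {k..<k + m}) = {a, k, k + 1}"
      using a(2) 3(2) by auto
    ultimately have "card {a, k, k + 1} \<le> 2"
      unfolding eq skeleton_def by simp
    then show ?thesis using \<open>a \<noteq> k\<close> \<open>a \<noteq> k + 1\<close> by simp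
  qed
qed


section \<open>A prime complex for composition\<close>

text \<open>
  A face \<open>I\<close> of \<open>K\<close> that contains \<open>k\<close> would turn the whole block into a face.
  If the block is not a face, only the faces \<open>I\<close> that avoid \<open>k\<close> remain, and for them
  \<open>I \<circ>\<^sup>c\<^sub>k J\<close> is the disjoint union of \<open>I\<close> and \<open>J\<close> up to renumbering.
\<close>

lemma com_comp_join:
  assumes K: "K \<in> scpx n" and L: "L \<in> scpx m" and k: "k \<in> {1..n}"
    and block: "{k..<k + m} \<notin> com_comp m k K L"
    and S: "S \<in> com_comp m k K L" and T: "T \<in> com_comp m k K L"
  shows "(S - {k..<k + m}) \<union> (T \<inter> {k..<k + m}) \<in> com_comp m k K L"
proof -
  obtain I J I' J' where *: "I \<in> K" "J \<in> L" "S \<subseteq> com_set m k I J"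
      "I' \<in> K" "J' \<in> L" "T \<subseteq> com_set m k I' J'"
    using S(1) T(1) unfolding com_comp_def by blast
  have km: "1 \<le> k" "1 \<le> m" using k scpxD(2)[OF L] by auto
  note mem = mem_com_set[OF km scpxD(1)[OF L]]
  have "k \<notin> I'"
  proof
    assume "k \<in> I'"
    then have "{k..<k + m} \<subseteq> com_set m k I' J'"
      using * by (auto simp: mem)
    then show False using block * unfolding com_comp_def by blast
  qed
  have "a \<in> com_set m k I J'" if "a \<in> (S - {k..<k + m}) \<union> (T \<inter> {k..<k + m})" for a
  proof (cases "a \<in> {k..<k + m}")
    case True
    then have "a \<in> com_set m k I' J'" using that *(6) by blast
    then show ?thesis using True \<open>k \<notin> I'\<close> by (simp add: mem *(2,5))
  next
    case False
    then have "a \<in> com_set m k I J" using that *(3) by blast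
    then show ?thesis using False by (auto simp: mem *(2,5) split: if_splits)
  qed
  then have "(S - {k..<k + m}) \<union> (T \<inter> {k..<k + m}) \<subseteq> com_set m k I J'" by blast
  then show ?thesis using * unfolding com_comp_def by blast
qed

lemma skeleton_1_com_prime:
  assumes K: "K \<in> scpx n" and L: "L \<in> scpx m" and k: "k \<in> {1..n}" and "2 \<le> n + m - 1"
    and eq: "com_comp m k K L = skeleton 1 (n + m - 1)"
  shows "m = 1 \<and> K = skeleton 1 n \<or> n = 1 \<and> L = skeleton 1 m"
proof -
  have km: "1 \<le> k" "1 \<le> m" "1 \<le> n" using k scpxD(2)[OF L] by auto
  have ne: "K \<noteq> {}" "L \<noteq> {}"
    using comp_nonempty(2)[of m k K L] skeleton_in_scpx_nonempty[of "n + m - 1" 1] assms(4) eq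
    by (auto simp: scpx_nonempty_def)
  have face_card: "card S \<le> 1" if "I \<in> K" "J \<in> L" "S \<subseteq> com_set m k I J" for I J S
  proof -
    have "S \<in> com_comp m k K L" using that unfolding com_comp_def by blast
    then show ?thesis unfolding eq skeleton_def by simp
  qed
  consider "m = 1" | "n = 1" "2 \<le> m" | "2 \<le> n" "2 \<le> m" using km by linarith
  then show ?thesis
  proof cases
    case 1
    have "L \<noteq> {{}, {1}}"
    proof
      \<comment> \<open>With this \<open>L\<close> the composite is a cone with apex \<open>k\<close>, so every other vertex spans an
        edge with \<open>k\<close>.\<close>
      assume L1: "L = {{}, {1}}"
      obtain a where a: "a \<in> {1..n}" "a \<noteq> k"
        using ex_outside_block[OF k, of 1] assms(4) 1 by auto
      then have "{a} \<in> com_comp m k K L" unfolding eq skeleton_def using 1 by simp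
      then obtain I J where IJ: "I \<in> K" "J \<in> L" "{a} \<subseteq> com_set m k I J"
        unfolding com_comp_def by blast
      then have "{a, k} \<subseteq> com_set m k I {1}"
        using a 1 k L1 by (auto simp: mem_com_set split: if_splits)
      from face_card[OF IJ(1) _ this] L1 a(2) show False by simp
    qed
    then have "L = {{}}" using scpx_1_cases[of L] L ne 1 by auto
    then show ?thesis using com_comp_unit_right[OF K k] eq 1 by simp
  next
    case 2
    then have k1: "k = 1" using k by simp
    have "K \<noteq> {{}, {1}}"
    proof
      assume "K = {{}, {1}}"
      moreover obtain J where "J \<in> L" using ne by blast
      moreover have "{1..m} \<subseteq> com_set m k {1} J"
        unfolding com_set_def k1 by auto
      ultimately have "card {1..m} \<le> 1" by (intro face_card[of "{1}" J]) auto
      then show False using 2 by simp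
    qed
    then have "K = {{}}" using scpx_1_cases[of K] K ne 2 by auto
    then show ?thesis using com_comp_unit_left[OF L] eq 2 k1 by simp
  next
    case 3
    obtain a where a: "a \<in> {1..n + m - 1}" "a \<notin> {k..<k + m}"
      using ex_outside_block[OF k 3(1)] .
    have "a \<noteq> k" using a(2) 3(2) by auto
    have "{k..<k + m} \<notin> com_comp m k K L"
      unfolding eq skeleton_def using 3(2) by simp
    moreover have "{a} \<in> com_comp m k K L" "{k} \<in> com_comp m k K L"
      unfolding eq skeleton_def using a(1) k km by auto
    ultimately have "({a} - {k..<k + m}) \<union> ({k} \<inter> {k..<k + m}) \<in> com_comp m k K L"
      by (rule com_comp_join[OF K L k])
    moreover have "({a} - {k..<k + m}) \<union> ({k} \<inter> {k..<k + m}) = {a, k}"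
      using a(2) 3(2) by auto
    ultimately have "card {a, k} \<le> 1"
      unfolding eq skeleton_def by simp
    then show ?thesis using \<open>a \<noteq> k\<close> by simp
  qed
qed


section \<open>The four operads\<close>

lemma substitution_operad_not_finitely_generated:
  assumes "C = scpx \<or> C = scpx_nonempty"
  shows "\<not> finitely_generated (substitution_operad\<lparr>ops := C\<rparr>)"
proof (rule not_finitely_generatedI[where N = 3 and b = "skeleton 2"])
  have C: "x \<in> C n \<Longrightarrow> x \<in> scpx n" "x \<in> scpx_nonempty n \<Longrightarrow> x \<in> C n" for x n
    using assms by (auto simp: scpx_nonempty_def)
  show "skeleton 2 n \<in> ops (substitution_operad\<lparr>ops := C\<rparr>) n" if "3 \<le> n" for n
    using that C(2) skeleton_in_scpx_nonempty by simp
  show "m = 1 \<and> K = skeleton 2 n \<or> n = 1 \<and> L = skeleton 2 m"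
    if "K \<in> ops (substitution_operad\<lparr>ops := C\<rparr>) n" "L \<in> ops (substitution_operad\<lparr>ops := C\<rparr>) m"
      "k \<in> {1..n}" "3 \<le> n + m - 1"
      "pcomp (substitution_operad\<lparr>ops := C\<rparr>) n m k K L = skeleton 2 (n + m - 1)" for K L n m k
    using that by (intro skeleton_2_sub_prime C(1)) (simp_all add: substitution_operad_def)
  show "K = skeleton 2 n"
    if "\<sigma> permutes {1..n}" "act (substitution_operad\<lparr>ops := C\<rparr>) n \<sigma> K = skeleton 2 n" for n \<sigma> K
    using relabel_eq_skeletonD[OF that(1)] that(2) by (simp add: substitution_operad_def)
qed simp

lemma composition_operad_not_finitely_generated:
  assumes "C = scpx \<or> C = scpx_nonempty"
  shows "\<not> finitely_generated (composition_operad\<lparr>ops := C\<rparr>)"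
proof (rule not_finitely_generatedI[where N = 2 and b = "skeleton 1"])
  have C: "x \<in> C n \<Longrightarrow> x \<in> scpx n" "x \<in> scpx_nonempty n \<Longrightarrow> x \<in> C n" for x n
    using assms by (auto simp: scpx_nonempty_def)
  show "skeleton 1 n \<in> ops (composition_operad\<lparr>ops := C\<rparr>) n" if "2 \<le> n" for n
    using that C(2) skeleton_in_scpx_nonempty by simp
  show "m = 1 \<and> K = skeleton 1 n \<or> n = 1 \<and> L = skeleton 1 m"
    if "K \<in> ops (composition_operad\<lparr>ops := C\<rparr>) n" "L \<in> ops (composition_operad\<lparr>ops := C\<rparr>) m"
      "k \<in> {1..n}" "2 \<le> n + m - 1"
      "pcomp (composition_operad\<lparr>ops := C\<rparr>) n m k K L = skeleton 1 (n + m - 1)" for K L n m k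
    using that by (intro skeleton_1_com_prime C(1)) (simp_all add: composition_operad_def)
  show "K = skeleton 1 n"
    if "\<sigma> permutes {1..n}" "act (composition_operad\<lparr>ops := C\<rparr>) n \<sigma> K = skeleton 1 n" for n \<sigma> K
    using relabel_eq_skeletonD[OF that(1)] that(2) by (simp add: composition_operad_def)
qed simp

theorem theorem3p21:
  "\<not> finitely_generated substitution_operad
   \<and> \<not> finitely_generated substitution_operad_nonempty
   \<and> \<not> finitely_generated composition_operad
   \<and> \<not> finitely_generated composition_operad_nonempty"
  using substitution_operad_not_finitely_generated[of scpx]
    substitution_operad_not_finitely_generated[of scpx_nonempty]
    composition_operad_not_finitely_generated[of scpx]
    composition_operad_not_finitely_generated[of scpx_nonempty]
  by (simp add: substitution_operad_def substitution_operad_nonempty_def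
      composition_operad_def composition_operad_nonempty_def)

end
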